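(* Let $\delta>0$, let $\mathcal{S}=\{S_1,\dots,S_m\}$ be a contractible $P$-polygonal system of similarities with attractor $K$, and let $\mathcal{S}'=\{S'_1,\dots,S'_m\}$ be a generalized $P'$-polygonal system which is a $\delta$-deformation of $\mathcal{S}$, with attractor $K'$. Let $\pi:I^\infty\to K$ and $\pi':I^\infty\to K'$ be the respective address maps. (i) There is a unique continuous map $\hat f:K\to K'$ such that $\hat f\circ\pi=\pi'$. (ii) If $S'_i(K')\cap S'_j(K')=P'_i\cap P'_j$ for all $i\neq j$ in $I$ (where $P'_i=S'_i(P')$), then $\hat f$ is a homeomorphism.
   Context: The plane $\mathbb{R}^2$ is identified with $\mathbb{C}$. All systems $\mathcal{S}=\{S_1,\dots,S_m\}$ consist of contracting similarities of the form $S_j(z)=q_je^{i\alpha_j}(z-z_j)+z_j$ with $0<q_j<1$. The attractor of $\mathcal{S}$ is the unique nonempty compact set $K$ with $K=\bigcup_{j=1}^m S_j(K)$. Put $I=\{1,\dots,m\}$, and for a word $\mathbf{j}=j_1\dots j_n$ over $I$ put $S_{\mathbf{j}}=S_{j_1}\circ\dots\circ S_{j_n}$ and $K_{\mathbf{j}}=S_{\mathbf{j}}(K)$. $I^\infty$ is the set of infinite sequences over $I$, and the address map $\pi:I^\infty\to K$ sends $\sigma_1\sigma_2\dots$ to the unique point of $\bigcap_{n\ge1}K_{\sigma_1\dots\sigma_n}$. A polygon $P\subset\mathbb{R}^2$ means a (closed) polygon with finitely many vertices, homeomorphic to a disk; $\mathcal{V}_P$ is its set of vertices. For $i\in I$ put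 $P_i=S_i(P)$ and $\mathcal{V}_{P_i}=S_i(\mathcal{V}_P)$. Consider the conditions: (D1) $P_i\subset P$ for all $i\in I$; (D2) for all $i\ne j$ in $I$, $P_i\cap P_j=\mathcal{V}_{P_i}\cap\mathcal{V}_{P_j}$ and this set has fewer than two elements; (D3) $\mathcal{V}_P\subset\bigcup_{i\in I}S_i(\mathcal{V}_P)$; (D4) the set $\bigcup_{i=1}^m P_i$ is contractible. $\mathcal{S}$ is a contractible $P$-polygonal system if (D1)–(D4) hold, and a generalized $P$-polygonal system if (D2)–(D4) hold. A generalized $P'$-polygonal system $\mathcal{S}'=\{S'_1,\dots,S'_m\}$ is a $\delta$-deformation of a contractible $P$-polygonal system $\mathcal{S}=\{S_1,\dots,S_m\}$ if there is a bijection $f:\bigcup_{k=1}^m\mathcal{V}_{P_k}\to\bigcup_{k=1}^m\mathcal{V}_{P'_k}$ (where $P'_k=S'_k(P')$) such that: (a) $f(\mathcal{V}_P)=\mathcal{V}_{P'}$ and $f|_{\mathcal{V}_P}$ extends to a homeomorphism $P\to P'$; (b) $|f(x)-x|<\delta$ for every $x\in\bigcup_k\mathcal{V}_{P_k}$; (c) $f(S_k(x))=S'_k(f(x))$ for every $k\in I$ and $x\in\mathcal{V}_P$. *)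

theory Defs
  imports "HOL-Analysis.Analysis" "HOL-Library.Stream"
begin

fun polyline :: "complex list \<Rightarrow> real \<Rightarrow> complex" where
  "polyline [] = linepath 0 0"
| "polyline [a] = linepath a a"
| "polyline [a, b] = linepath a b"
| "polyline (a # b # c # cs) = linepath a b +++ polyline (b # c # cs)"

definition closed_polyline :: "complex list \<Rightarrow> real \<Rightarrow> complex" where
  "closed_polyline vs = polyline (vs @ [hd vs])"

text \<open>
  A list of points that enumerates, in cyclic order, the corners of a simple closed polygonal
  curve. Simplicity of the curve excludes repeated points and spikes, so the collinearity
  condition excludes exactly the straight angles.
\<close>
definition polygon_corners :: "complex list \<Rightarrow> bool" where
  "polygon_corners vs \<longleftrightarrow>
     length vs \<ge> 3 \<and>
     simple_path (closed_polyline vs) \<and>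
     (\<forall>i < length vs. \<not> collinear
        {vs ! i, vs ! ((i + 1) mod length vs), vs ! ((i + 2) mod length vs)})"

definition polygon_region :: "complex list \<Rightarrow> complex set" where
  "polygon_region vs =
     path_image (closed_polyline vs) \<union> inside (path_image (closed_polyline vs))"

text \<open>
  The second conjunct is implied by the first one (Schoenflies theorem).
\<close>
definition polygon :: "complex set \<Rightarrow> bool" where
  "polygon P \<longleftrightarrow>
     (\<exists>vs. polygon_corners vs \<and> P = polygon_region vs) \<and>
     P homeomorphic cball (0 :: complex) 1"

text \<open>
  Since straight angles are excluded, the list of corners of a polygon is determined by the
  polygon up to cyclic rotation and reversal; its underlying set is the set of vertices.
\<close>
definition vertices :: "complex set \<Rightarrow> complex set" where
  "vertices P = {v. \<exists>vs. polygon_corners vs \<and> P = polygon_region vs \<and> v \<in> set vs}"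

definition contracting_similarity :: "(complex \<Rightarrow> complex) \<Rightarrow> bool" where
  "contracting_similarity T \<longleftrightarrow>
     (\<exists>(q :: real) (\<alpha> :: real) (z0 :: complex). 0 < q \<and> q < 1 \<and>
        T = (\<lambda>z. of_real q * exp (\<i> * of_real \<alpha>) * (z - z0) + z0))"

text \<open>
  A system of \<open>m\<close> maps is a function \<open>S\<close> of which only the values \<open>S 1, \<dots>, S m\<close> matter.
\<close>
definition generalized_polygonal_system ::
    "nat \<Rightarrow> (nat \<Rightarrow> complex \<Rightarrow> complex) \<Rightarrow> complex set \<Rightarrow> bool" where
  "generalized_polygonal_system m S P \<longleftrightarrow>
     polygon P \<and>
     (\<forall>i \<in> {1..m}. contracting_similarity (S i)) \<and>
     (\<forall>i \<in> {1..m}. \<forall>j \<in> {1..m}. i \<noteq> j \<longrightarrow>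
        S i ` P \<inter> S j ` P = S i ` vertices P \<inter> S j ` vertices P \<and>
        finite (S i ` P \<inter> S j ` P) \<and> card (S i ` P \<inter> S j ` P) < 2) \<and>
     vertices P \<subseteq> (\<Union>i \<in> {1..m}. S i ` vertices P) \<and>
     contractible (\<Union>i \<in> {1..m}. S i ` P)"

definition contractible_polygonal_system ::
    "nat \<Rightarrow> (nat \<Rightarrow> complex \<Rightarrow> complex) \<Rightarrow> complex set \<Rightarrow> bool" where
  "contractible_polygonal_system m S P \<longleftrightarrow>
     generalized_polygonal_system m S P \<and> (\<forall>i \<in> {1..m}. S i ` P \<subseteq> P)"

definition is_deformation ::
    "real \<Rightarrow> nat \<Rightarrow> (nat \<Rightarrow> complex \<Rightarrow> complex) \<Rightarrow> complex set \<Rightarrow>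
     (nat \<Rightarrow> complex \<Rightarrow> complex) \<Rightarrow> complex set \<Rightarrow> bool" where
  "is_deformation \<delta> m S P S' P' \<longleftrightarrow>
     (\<exists>f. bij_betw f (\<Union>k \<in> {1..m}. S k ` vertices P) (\<Union>k \<in> {1..m}. S' k ` vertices P') \<and>
        f ` vertices P = vertices P' \<and>
        (\<exists>h h'. homeomorphism P P' h h' \<and> (\<forall>x \<in> vertices P. h x = f x)) \<and>
        (\<forall>x \<in> (\<Union>k \<in> {1..m}. S k ` vertices P). norm (f x - x) < \<delta>) \<and>
        (\<forall>k \<in> {1..m}. \<forall>x \<in> vertices P. f (S k x) = S' k (f x)))"

definition is_attractor ::
    "nat \<Rightarrow> (nat \<Rightarrow> complex \<Rightarrow> complex) \<Rightarrow> complex set \<Rightarrow> bool" where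
  "is_attractor m S K \<longleftrightarrow> compact K \<and> K \<noteq> {} \<and> K = (\<Union>j \<in> {1..m}. S j ` K)"

primrec word_map :: "(nat \<Rightarrow> complex \<Rightarrow> complex) \<Rightarrow> nat list \<Rightarrow> complex \<Rightarrow> complex" where
  "word_map S [] = id"
| "word_map S (j # js) = S j \<circ> word_map S js"

definition address_map ::
    "(nat \<Rightarrow> complex \<Rightarrow> complex) \<Rightarrow> complex set \<Rightarrow> nat stream \<Rightarrow> complex" where
  "address_map S K \<sigma> = (THE x. x \<in> (\<Inter>n \<in> {1..}. word_map S (stake n \<sigma>) ` K))"

text \<open>
  The set \<open>K \<rightarrow>\<^sub>E K'\<close> of functions that are fixed outside \<open>K\<close> represents the maps from
  \<open>K\<close> to \<open>K'\<close>, so that equality of HOL functions is equality of maps on \<open>K\<close>.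
\<close>
definition address_preserving ::
    "nat \<Rightarrow> (nat \<Rightarrow> complex \<Rightarrow> complex) \<Rightarrow> complex set \<Rightarrow>
     (nat \<Rightarrow> complex \<Rightarrow> complex) \<Rightarrow> complex set \<Rightarrow> (complex \<Rightarrow> complex) \<Rightarrow> bool" where
  "address_preserving m S K S' K' g \<longleftrightarrow>
     g \<in> K \<rightarrow>\<^sub>E K' \<and> continuous_on K g \<and>
     (\<forall>\<sigma> \<in> streams {1..m}. g (address_map S K \<sigma>) = address_map S' K' \<sigma>)"

end

theory Submission
  imports Defs
begin

text \<open>
  The candidate map sends \<open>\<pi> \<sigma>\<close> to \<open>\<pi>' \<sigma>\<close>, so it is well defined if \<open>\<pi> \<sigma> = \<pi> \<tau>\<close> forces
  \<open>\<pi>' \<sigma> = \<pi>' \<tau>\<close>. Removing the common prefix, one may assume that \<open>\<sigma>\<close> and \<open>\<tau>\<close> start with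
  different letters \<open>i\<close>, \<open>j\<close>; then the common point is \<open>S i u = S j v\<close> with vertices \<open>u\<close>, \<open>v\<close>
  of \<open>P\<close>. Tails of addresses of vertices are again addresses of vertices, so the vertex map \<open>f\<close>
  carries them along and \<open>\<pi>' \<sigma> = f (S i u) = f (S j v) = \<pi>' \<tau>\<close>. The only properties used are
  that distinct pieces of the attractor meet in images of vertices and that vertices are images
  of vertices; under the hypothesis of (ii) the deformed system has them too, and the same
  argument with the inverse of \<open>f\<close> gives injectivity.
\<close>

section \<open>Attractors and addresses\<close>

text \<open>Simplification keeps \<open>{1..m}\<close> as an opaque index set: membership is not
  unfolded into inequalities and 1 is not rewritten to a successor.\<close>

declare One_nat_def [simp del] atLeastAtMost_iff [simp del]

text \<open>The factor \<open>exp (\<i> * of_real \<alpha>)\<close> has norm 1, so only the ratio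
  survives. An equation with positive ratio is kept, not just a bound, because injectivity is read
  off from it.\<close>

lemma contracting_similarity_dist:
  assumes "contracting_similarity T"
  obtains q where "0 < q" "q < 1" "\<And>x y. dist (T x) (T y) = q * dist x y"
proof -
  from assms obtain q :: real and \<alpha> :: real and z0 where q: "0 < q" "q < 1"
    and T: "T = (\<lambda>z. of_real q * exp (\<i> * of_real \<alpha>) * (z - z0) + z0)"
    unfolding contracting_similarity_def by blast
  have "dist (T x) (T y) = q * dist x y" for x y
  proof -
    have "T x - T y = of_real q * exp (\<i> * of_real \<alpha>) * (x - y)"
      unfolding T by (simp add: algebra_simps)
    then show ?thesis
      using q by (simp add: dist_norm norm_mult)
  qed
  with q show ?thesis
    by (rule that)
qed

locale similarity_ifs =
  fixes m :: nat and S :: "nat \<Rightarrow> complex \<Rightarrow> complex" and K :: "complex set"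
  assumes similarity: "i \<in> {1..m} \<Longrightarrow> contracting_similarity (S i)"
    and attractor: "is_attractor m S K"
begin

abbreviation \<pi> :: "nat stream \<Rightarrow> complex" where
  "\<pi> \<equiv> address_map S K"

lemma uniform_ratio:
  obtains q where "0 \<le> q" "q < 1"
    "\<And>i x y. i \<in> {1..m} \<Longrightarrow> dist (S i x) (S i y) \<le> q * dist x y"
proof -
  have "\<exists>q. i \<in> {1..m} \<longrightarrow> 0 < q \<and> q < 1 \<and> (\<forall>x y. dist (S i x) (S i y) = q * dist x y)" for i
    using contracting_similarity_dist[OF similarity] by metis
  then obtain r where r: "\<And>i. i \<in> {1..m} \<Longrightarrow> 0 < r i \<and> r i < 1"
    "\<And>i x y. i \<in> {1..m} \<Longrightarrow> dist (S i x) (S i y) = r i * dist x y"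
    by metis
  \<comment> \<open>Inserting 0 makes the maximum range over a nonempty set without a case
    distinction on \<open>m\<close>, and yields \<open>0 \<le> q\<close>.\<close>
  define q where "q = Max (insert 0 (r ` {1..m}))"
  have "0 \<le> q" "q < 1"
    unfolding q_def using r(1) by (auto simp: Max_ge_iff)
  moreover have "dist (S i x) (S i y) \<le> q * dist x y" if "i \<in> {1..m}" for i x y
  proof -
    have "r i \<le> q"
      unfolding q_def using that by (intro Max_ge) auto
    then show ?thesis
      by (simp add: r(2)[OF that] mult_right_mono)
  qed
  ultimately show ?thesis
    by (rule that)
qed

lemma inj_S: "i \<in> {1..m} \<Longrightarrow> S i x = S i y \<Longrightarrow> x = y"
  using contracting_similarity_dist[OF similarity, of i]
  by (metis dist_self less_irrefl mult_eq_0_iff zero_less_dist_iff)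

lemma compact_K: "compact K" and K_nonempty: "K \<noteq> {}"
  and K_eq: "K = (\<Union>j \<in> {1..m}. S j ` K)"
  using attractor unfolding is_attractor_def by auto

lemma S_in_K: "i \<in> {1..m} \<Longrightarrow> x \<in> K \<Longrightarrow> S i x \<in> K"
  using K_eq by blast

section \<open>Word maps and the shrinking of their images\<close>

lemma dist_word_map:
  assumes "0 \<le> q" "\<And>i x y. i \<in> {1..m} \<Longrightarrow> dist (S i x) (S i y) \<le> q * dist x y"
    and "set w \<subseteq> {1..m}"
  shows "dist (word_map S w x) (word_map S w y) \<le> q ^ length w * dist x y"
  using assms(3)
proof (induction w)
  case (Cons i w)
  have "dist (S i (word_map S w x)) (S i (word_map S w y))
      \<le> q * dist (word_map S w x) (word_map S w y)"
    using Cons.prems by (intro assms(2)) auto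
  also have "\<dots> \<le> q * (q ^ length w * dist x y)"
    using Cons by (intro mult_left_mono assms(1)) auto
  finally show ?case
    by (simp add: mult.assoc)
qed auto

lemma word_map_image_subset: "set w \<subseteq> {1..m} \<Longrightarrow> word_map S w ` K \<subseteq> K"
  by (induction w) (auto intro: S_in_K)

lemma continuous_on_word_map:
  assumes "set w \<subseteq> {1..m}"
  shows "continuous_on A (word_map S w)"
proof -
  obtain q where q: "0 \<le> q" "q < 1"
    "\<And>i x y. i \<in> {1..m} \<Longrightarrow> dist (S i x) (S i y) \<le> q * dist x y"
    using uniform_ratio by blast
  show ?thesis
  proof (rule lipschitz_on_continuous_on)
    show "(q ^ length w)-lipschitz_on A (word_map S w)"
      using dist_word_map[OF q(1,3) assms] q(1) by (intro lipschitz_onI) auto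
  qed
qed

lemma compact_word_map_image: "set w \<subseteq> {1..m} \<Longrightarrow> compact (word_map S w ` K)"
  by (intro compact_continuous_image continuous_on_word_map compact_K)

lemma word_map_append: "word_map S (v @ w) = word_map S v \<circ> word_map S w"
  by (induction v) auto

text \<open>The level \<open>n\<close> depends only on the bound \<open>q ^ n * D\<close>, hence
  serves all words of length \<open>n\<close> at once. The set is an arbitrary bounded
  \<open>A\<close> because the estimate is later applied to sets larger than the attractor.\<close>

lemma word_map_images_shrink:
  assumes "\<epsilon> > 0" "bounded A"
  obtains n where "\<And>w x y. set w \<subseteq> {1..m} \<Longrightarrow> length w = n \<Longrightarrow> x \<in> A \<Longrightarrow> y \<in> A \<Longrightarrow>
    dist (word_map S w x) (word_map S w y) < \<epsilon>"
proof -
  obtain q where q: "0 \<le> q" "q < 1"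
    "\<And>i x y. i \<in> {1..m} \<Longrightarrow> dist (S i x) (S i y) \<le> q * dist x y"
    using uniform_ratio by blast
  obtain D where D: "\<And>x y. x \<in> A \<Longrightarrow> y \<in> A \<Longrightarrow> dist x y \<le> D"
    using assms(2) by (metis bounded_two_points)
  have "(\<lambda>n. q ^ n * D) \<longlonglongrightarrow> 0 * D"
    using q by (intro tendsto_intros LIMSEQ_realpow_zero) auto
  then have "eventually (\<lambda>n. q ^ n * D < \<epsilon>) sequentially"
    using assms(1) by (intro order_tendstoD(2)) auto
  then obtain n where n: "q ^ n * D < \<epsilon>"
    by (auto simp: eventually_sequentially)
  show ?thesis
  proof (rule that)
    fix w x y assume *: "set w \<subseteq> {1..m}" "length w = n" "x \<in> A" "y \<in> A"
    have "dist (word_map S w x) (word_map S w y) \<le> q ^ n * dist x y"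
      using dist_word_map[OF q(1,3) *(1)] *(2) by metis
    also have "\<dots> \<le> q ^ n * D"
      using D * q(1) by (intro mult_left_mono) auto
    finally show "dist (word_map S w x) (word_map S w y) < \<epsilon>"
      using n by simp
  qed
qed

section \<open>The address map\<close>

lemma set_stake: "\<sigma> \<in> streams {1..m} \<Longrightarrow> set (stake n \<sigma>) \<subseteq> {1..m}"
  by (induction n arbitrary: \<sigma>) (auto simp: streams_stl streams_shd)

text \<open>Uniqueness half of the address map: both points lie in sets of arbitrarily small
  diameter.\<close>

lemma eq_if_in_all_word_map_images:
  assumes "\<sigma> \<in> streams {1..m}" "bounded A"
    and "\<And>n. x \<in> word_map S (stake n \<sigma>) ` A" "\<And>n. y \<in> word_map S (stake n \<sigma>) ` A"
  shows "x = y"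
proof (rule ccontr)
  assume "x \<noteq> y"
  then obtain n where n: "\<And>w x' y'. set w \<subseteq> {1..m} \<Longrightarrow> length w = n \<Longrightarrow> x' \<in> A \<Longrightarrow> y' \<in> A \<Longrightarrow>
    dist (word_map S w x') (word_map S w y') < dist x y"
    using word_map_images_shrink[OF _ assms(2), of "dist x y"] by auto
  obtain x' y' where "x' \<in> A" "y' \<in> A"
    "x = word_map S (stake n \<sigma>) x'" "y = word_map S (stake n \<sigma>) y'"
    using assms(3,4)[of n] by blast
  then show False
    using n[OF set_stake[OF assms(1)], of n x' y'] by auto
qed

text \<open>Existence half of the address map: the images are nonempty, compact and nested, so they
  share a point, and uniqueness turns the definite description into that point.\<close>

lemma address_in:
  assumes "\<sigma> \<in> streams {1..m}"
  shows "\<pi> \<sigma> \<in> word_map S (stake n \<sigma>) ` K"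
proof -
  let ?F = "\<lambda>n. word_map S (stake n \<sigma>) ` K"
  have step: "?F (Suc n) \<subseteq> ?F n" for n
  proof -
    have "stake (Suc n) \<sigma> = stake n \<sigma> @ [\<sigma> !! n]"
      by (rule stake_Suc)
    moreover have "\<sigma> !! n \<in> {1..m}"
      using assms by (simp add: streams_iff_snth)
    ultimately show ?thesis
      by (auto simp: word_map_append simp del: stake.simps(2) intro!: imageI S_in_K)
  qed
  have "\<Inter> (range ?F) \<noteq> {}"
  proof (rule compact_nest)
    show "compact (?F n)" "?F n \<noteq> {}" for n
      using compact_word_map_image[OF set_stake[OF assms]] K_nonempty by auto
    show "?F k \<subseteq> ?F n" if "n \<le> k" for n k
      using lift_Suc_antimono_le[of ?F, OF step that] .
  qed
  then obtain x where x: "\<And>n. x \<in> ?F n"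
    by auto
  have sub: "?F n \<subseteq> K" for n
    by (rule word_map_image_subset[OF set_stake[OF assms]])
  have "\<pi> \<sigma> = x"
    unfolding address_map_def
  proof (rule the_equality)
    show "x \<in> (\<Inter>n\<in>{1..}. ?F n)"
      using x by auto
    fix y assume y: "y \<in> (\<Inter>n\<in>{1..}. ?F n)"
    \<comment> \<open>The defining intersection starts at \<open>n = 1\<close>; the case
      \<open>n = 0\<close>, which is \<open>K\<close> itself, follows from the case
      \<open>n = 1\<close>.\<close>
    then have "y \<in> ?F n" if "n \<ge> 1" for n
      using that by blast
    moreover from this have "y \<in> ?F 0"
      using sub[of 1] by auto
    ultimately have "y \<in> ?F n" for n
      by (cases "n = 0") auto
    then show "y = x"
      using eq_if_in_all_word_map_images[OF assms compact_imp_bounded[OF compact_K]] x by blast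
  qed
  then show ?thesis
    using x by simp
qed

lemma address_in_K: "\<sigma> \<in> streams {1..m} \<Longrightarrow> \<pi> \<sigma> \<in> K"
  using address_in[of \<sigma> 0] by simp

lemma address_eqI:
  assumes "\<sigma> \<in> streams {1..m}" "\<And>n. x \<in> word_map S (stake n \<sigma>) ` K"
  shows "\<pi> \<sigma> = x"
  using eq_if_in_all_word_map_images[OF assms(1) compact_imp_bounded[OF compact_K]]
    address_in[OF assms(1)] assms(2) by blast

lemma address_SCons:
  assumes "i \<in> {1..m}" "\<sigma> \<in> streams {1..m}"
  shows "\<pi> (i ## \<sigma>) = S i (\<pi> \<sigma>)"
proof (rule address_eqI)
  show "i ## \<sigma> \<in> streams {1..m}"
    using assms by auto
  show "S i (\<pi> \<sigma>) \<in> word_map S (stake n (i ## \<sigma>)) ` K" for n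
  proof (cases n)
    case 0
    then show ?thesis
      using assms by (auto intro: S_in_K address_in_K)
  next
    case (Suc k)
    then show ?thesis
      using address_in[OF assms(2), of k] by (auto simp: image_comp[symmetric])
  qed
qed

lemma address_shift:
  assumes "set w \<subseteq> {1..m}" "\<sigma> \<in> streams {1..m}"
  shows "\<pi> (w @- \<sigma>) = word_map S w (\<pi> \<sigma>)"
  using assms(1)
proof (induction w)
  case (Cons i w)
  then have "w @- \<sigma> \<in> streams {1..m}"
    using assms(2) by (auto intro: shift_streams)
  with Cons show ?case
    by (auto simp: address_SCons)
qed auto

lemma address_cases:
  assumes "\<sigma> \<in> streams {1..m}"
  obtains i \<rho> where "\<sigma> = i ## \<rho>" "i \<in> {1..m}" "\<rho> \<in> streams {1..m}" "\<pi> \<sigma> = S i (\<pi> \<rho>)"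
  using assms address_SCons by (cases \<sigma>) auto

text \<open>Each point of \<open>K\<close> gets a chosen letter \<open>c x\<close> and a chosen
  preimage \<open>r x\<close> in \<open>K\<close>. The letters met along the orbit of
  \<open>x\<close> under \<open>r\<close> form an address of \<open>x\<close>.\<close>

lemma address_surj:
  assumes "x \<in> K"
  obtains \<sigma> where "\<sigma> \<in> streams {1..m}" "\<pi> \<sigma> = x"
proof -
  have "\<forall>x\<in>K. \<exists>i y. i \<in> {1..m} \<and> y \<in> K \<and> x = S i y"
    using K_eq by blast
  then obtain c r where cr: "\<And>x. x \<in> K \<Longrightarrow> c x \<in> {1..m}" "\<And>x. x \<in> K \<Longrightarrow> r x \<in> K"
    "\<And>x. x \<in> K \<Longrightarrow> S (c x) (r x) = x"
    by metis
  define \<sigma> where "\<sigma> y = smap c (siterate r y)" for y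
  have iter: "(r ^^ n) y \<in> K" if "y \<in> K" for n y
    using that cr(2) by (induction n) auto
  have str: "\<sigma> x \<in> streams {1..m}"
    using iter[OF assms] cr(1) by (auto simp: \<sigma>_def streams_iff_snth)
  have "y \<in> word_map S (stake n (\<sigma> y)) ` K" if "y \<in> K" for n y
    using that
  proof (induction n arbitrary: y)
    case (Suc n)
    have "\<sigma> y = c y ## \<sigma> (r y)"
      unfolding \<sigma>_def by (subst siterate.code) simp
    then show ?case
      using Suc.IH[OF cr(2)[OF Suc.prems]] cr(3)[OF Suc.prems]
      by (auto simp: image_iff) metis
  qed auto
  then have "\<pi> (\<sigma> x) = x"
    using address_eqI[OF str] assms by blast
  with str show ?thesis
    by (rule that)
qed

lemma word_map_cover:
  assumes "x \<in> K"
  obtains w where "set w \<subseteq> {1..m}" "length w = n" "x \<in> word_map S w ` K"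
proof -
  obtain \<sigma> where \<sigma>: "\<sigma> \<in> streams {1..m}" "\<pi> \<sigma> = x"
    using address_surj[OF assms] .
  show ?thesis
    using that[of "stake n \<sigma>"] set_stake[OF \<sigma>(1)] address_in[OF \<sigma>(1)] \<sigma>(2) by auto
qed

text \<open>A coinduction principle. An unequal related pair can be pulled back by one common map to
  a related pair, which is again unequal, so this never stops. Hence \<open>x\<close> and
  \<open>y\<close> lie in a common image of \<open>A\<close> under words of every length, and these
  images shrink to points.\<close>

lemma self_similar_pairs_eq:
  assumes "bounded A" "\<And>x y. R x y \<Longrightarrow> x \<in> A \<and> y \<in> A"
    and step: "\<And>x y. R x y \<Longrightarrow>
      x = y \<or> (\<exists>i \<in> {1..m}. \<exists>x' y'. x = S i x' \<and> y = S i y' \<and> R x' y')"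
    and "R x y"
  shows "x = y"
proof (rule ccontr)
  assume "x \<noteq> y"
  have word: "\<exists>w x' y'. set w \<subseteq> {1..m} \<and> length w = n \<and> x = word_map S w x' \<and>
      y = word_map S w y' \<and> R x' y'" if "R x y" "x \<noteq> y" for n x y
    using that
  proof (induction n arbitrary: x y)
    case 0
    then show ?case
      by auto
  next
    case (Suc n)
    from step[OF Suc.prems(1)] Suc.prems(2) obtain i x' y'
      where i: "i \<in> {1..m}" "x = S i x'" "y = S i y'" "R x' y'" "x' \<noteq> y'"
      by blast
    from Suc.IH[OF i(4,5)] obtain w x'' y'' where "set w \<subseteq> {1..m}" "length w = n"
      "x' = word_map S w x''" "y' = word_map S w y''" "R x'' y''"
      by blast
    then show ?case
      using i by (intro exI[of _ "i # w"] exI[of _ x''] exI[of _ y'']) simp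
  qed
  obtain n where n: "\<And>w x' y'. set w \<subseteq> {1..m} \<Longrightarrow> length w = n \<Longrightarrow> x' \<in> A \<Longrightarrow> y' \<in> A \<Longrightarrow>
    dist (word_map S w x') (word_map S w y') < dist x y"
    using word_map_images_shrink[OF _ assms(1), of "dist x y"] \<open>x \<noteq> y\<close> by auto
  obtain w x' y' where "set w \<subseteq> {1..m}" "length w = n" "x = word_map S w x'"
      "y = word_map S w y'" "R x' y'"
    using word[OF assms(4) \<open>x \<noteq> y\<close>] by blast
  then show False
    using n[of w x' y'] assms(2) by auto
qed

text \<open>Pulling a point of \<open>A\<close> back along \<open>n\<close> maps stays in
  \<open>A\<close>. Replacing the endpoint by a point of \<open>B\<close> and mapping forward gives
  a point of \<open>B\<close> that is close for large \<open>n\<close>; closedness finishes. This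
  serves to place vertices in the attractor and the attractor in the polygon.\<close>

lemma self_covering_subset:
  assumes "bounded A" "A \<subseteq> (\<Union>i \<in> {1..m}. S i ` A)"
    and "closed B" "B \<noteq> {}" "\<And>i. i \<in> {1..m} \<Longrightarrow> S i ` B \<subseteq> B"
  shows "A \<subseteq> B"
proof
  fix a assume "a \<in> A"
  obtain b where "b \<in> B"
    using assms(4) by blast
  \<comment> \<open>With \<open>b\<close> adjoined to \<open>A\<close>, a single shrinking estimate
    compares the images of \<open>b\<close> and of points of \<open>A\<close>.\<close>
  have "bounded (insert b A)"
    using assms(1) by simp
  have word: "\<exists>w a'. set w \<subseteq> {1..m} \<and> length w = n \<and> a' \<in> A \<and> a = word_map S w a'"
    if "a \<in> A" for n a
    using that
  proof (induction n arbitrary: a)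
    case 0
    then show ?case
      by auto
  next
    case (Suc n)
    then obtain i a' where i: "i \<in> {1..m}" "a' \<in> A" "a = S i a'"
      using assms(2) by blast
    from Suc.IH[OF i(2)] obtain w a'' where
      "set w \<subseteq> {1..m}" "length w = n" "a'' \<in> A" "a' = word_map S w a''"
      by blast
    then show ?case
      using i by (intro exI[of _ "i # w"] exI[of _ a'']) auto
  qed
  have inB: "word_map S w b \<in> B" if "set w \<subseteq> {1..m}" for w
    using that \<open>b \<in> B\<close> assms(5) by (induction w) auto
  have "\<exists>y\<in>B. dist y a < \<epsilon>" if "\<epsilon> > 0" for \<epsilon>
  proof -
    obtain n where n: "\<And>w x y. set w \<subseteq> {1..m} \<Longrightarrow> length w = n \<Longrightarrow> x \<in> insert b A \<Longrightarrow>
        y \<in> insert b A \<Longrightarrow> dist (word_map S w x) (word_map S w y) < \<epsilon>"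
      using word_map_images_shrink[OF \<open>\<epsilon> > 0\<close> \<open>bounded (insert b A)\<close>] by blast
    obtain w a' where w: "set w \<subseteq> {1..m}" "length w = n" "a' \<in> A" "a = word_map S w a'"
      using word[OF \<open>a \<in> A\<close>] by blast
    show ?thesis
      using n[OF w(1,2), of b a'] w inB[OF w(1)] by auto
  qed
  then show "a \<in> B"
    using assms(3) by (metis closed_approachable)
qed

end

section \<open>Transfer between two systems\<close>

locale ifs_pair = A: similarity_ifs m S K + B: similarity_ifs m S' K'
  for m S K S' K'
begin

text \<open>
  The set \<open>V\<close> plays the role of the vertices of the polygon and \<open>f\<close> that of the deformation.
\<close>
lemma address_eq_transfer:
  assumes V: "bounded V" "V \<subseteq> (\<Union>i \<in> {1..m}. S i ` V)"
    and meet: "\<And>i j. i \<in> {1..m} \<Longrightarrow> j \<in> {1..m} \<Longrightarrow> i \<noteq> j \<Longrightarrow>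
      S i ` K \<inter> S j ` K \<subseteq> S i ` V \<inter> S j ` V"
    and f: "bounded (f ` V)" "\<And>i x. i \<in> {1..m} \<Longrightarrow> x \<in> V \<Longrightarrow> f (S i x) = S' i (f x)"
    and \<sigma>\<tau>: "\<sigma> \<in> streams {1..m}" "\<tau> \<in> streams {1..m}" "A.\<pi> \<sigma> = A.\<pi> \<tau>"
  shows "B.\<pi> \<sigma> = B.\<pi> \<tau>"
proof -
  have "V \<subseteq> K"
    by (rule A.self_covering_subset[OF V compact_imp_closed[OF A.compact_K] A.K_nonempty])
       (use A.S_in_K in auto)
  \<comment> \<open>For addresses of points of \<open>V\<close>, the two sides are related by
    \<open>?R\<close>. Deleting the first letter of the address pulls both back by the same
    \<open>S' i\<close>, so coinduction applies once the tail is known to address a point of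
    \<open>V\<close>.\<close>
  have vertex: "B.\<pi> \<sigma> = f (A.\<pi> \<sigma>)" if "\<sigma> \<in> streams {1..m}" "A.\<pi> \<sigma> \<in> V" for \<sigma>
  proof -
    let ?R = "\<lambda>x y. \<exists>\<sigma> \<in> streams {1..m}. A.\<pi> \<sigma> \<in> V \<and> x = B.\<pi> \<sigma> \<and> y = f (A.\<pi> \<sigma>)"
    show ?thesis
    proof (rule B.self_similar_pairs_eq[of "K' \<union> f ` V" ?R])
      show "bounded (K' \<union> f ` V)"
        using f(1) B.compact_K compact_imp_bounded by auto
      show "x \<in> K' \<union> f ` V \<and> y \<in> K' \<union> f ` V" if "?R x y" for x y
        using that B.address_in_K by auto
      show "?R (B.\<pi> \<sigma>) (f (A.\<pi> \<sigma>))"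
        using that by auto
      show "x = y \<or> (\<exists>i \<in> {1..m}. \<exists>x' y'. x = S' i x' \<and> y = S' i y' \<and> ?R x' y')"
        if R: "?R x y" for x y
      proof -
        obtain \<sigma> where \<sigma>: "\<sigma> \<in> streams {1..m}" "A.\<pi> \<sigma> \<in> V" "x = B.\<pi> \<sigma>" "y = f (A.\<pi> \<sigma>)"
          using R by blast
        obtain i \<rho> where i: "\<sigma> = i ## \<rho>" "i \<in> {1..m}" "\<rho> \<in> streams {1..m}"
          "A.\<pi> \<sigma> = S i (A.\<pi> \<rho>)"
          using A.address_cases[OF \<sigma>(1)] .
        obtain k where k: "k \<in> {1..m}" "A.\<pi> \<sigma> \<in> S k ` V"
          using \<sigma>(2) V(2) by blast
        \<comment> \<open>The index \<open>k\<close> with the point in \<open>S k\<close>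
          V\<open>may differ from the first letter\<close>i\<open>. In that case the point is common to two pieces of\<close>K\<open>, and\<close>meet\<open>puts it into\<close>S
          i \<open>V\<close> as well.\<close>
        have "A.\<pi> \<sigma> \<in> S i ` V"
        proof (cases "k = i")
          case False
          have "A.\<pi> \<sigma> \<in> S k ` K" "A.\<pi> \<sigma> \<in> S i ` K"
            using k(2) \<open>V \<subseteq> K\<close> i(3,4) A.address_in_K by auto
          then show ?thesis
            using meet[OF i(2) k(1)] False by blast
        qed (use k in simp)
        then obtain u where "u \<in> V" "A.\<pi> \<sigma> = S i u"
          by blast
        then have u: "A.\<pi> \<rho> \<in> V"
          using A.inj_S[OF i(2)] i(4) by metis
        have "x = S' i (B.\<pi> \<rho>)" "y = S' i (f (A.\<pi> \<rho>))"
          using \<sigma>(3,4) i u f(2) B.address_SCons by auto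
        then show ?thesis
          using i(2,3) u by blast
      qed
    qed
  qed
  \<comment> \<open>Second coinduction: \<open>?Q\<close> relates the images of two addresses of one
    point. Equal first letters are cancelled, which pulls the pair back; different first letters
    give equality at once.\<close>
  let ?Q = "\<lambda>x y. \<exists>\<sigma> \<in> streams {1..m}. \<exists>\<tau> \<in> streams {1..m}.
    A.\<pi> \<sigma> = A.\<pi> \<tau> \<and> x = B.\<pi> \<sigma> \<and> y = B.\<pi> \<tau>"
  show ?thesis
  proof (rule B.self_similar_pairs_eq[of K' ?Q])
    show "bounded K'"
      using B.compact_K compact_imp_bounded by auto
    show "x \<in> K' \<and> y \<in> K'" if "?Q x y" for x y
      using that B.address_in_K by auto
    show "?Q (B.\<pi> \<sigma>) (B.\<pi> \<tau>)"
      using \<sigma>\<tau> by blast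
    show "x = y \<or> (\<exists>i \<in> {1..m}. \<exists>x' y'. x = S' i x' \<and> y = S' i y' \<and> ?Q x' y')"
      if Q: "?Q x y" for x y
    proof -
      obtain \<sigma> \<tau> where st: "\<sigma> \<in> streams {1..m}" "\<tau> \<in> streams {1..m}" "A.\<pi> \<sigma> = A.\<pi> \<tau>"
        "x = B.\<pi> \<sigma>" "y = B.\<pi> \<tau>"
        using Q by blast
      obtain i \<rho> where i: "\<sigma> = i ## \<rho>" "i \<in> {1..m}" "\<rho> \<in> streams {1..m}"
        "A.\<pi> \<sigma> = S i (A.\<pi> \<rho>)"
        using A.address_cases[OF st(1)] .
      obtain j \<upsilon> where j: "\<tau> = j ## \<upsilon>" "j \<in> {1..m}" "\<upsilon> \<in> streams {1..m}"
        "A.\<pi> \<tau> = S j (A.\<pi> \<upsilon>)"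
        using A.address_cases[OF st(2)] .
      have xy: "x = S' i (B.\<pi> \<rho>)" "y = S' j (B.\<pi> \<upsilon>)"
        using st(4,5) i j B.address_SCons by auto
      show ?thesis
      proof (cases "i = j")
        case True
        then have "A.\<pi> \<rho> = A.\<pi> \<upsilon>"
          using A.inj_S[OF i(2)] i(4) j(4) st(3) by metis
        then show ?thesis
          using xy i(2,3) j(3) True by blast
      next
        case False
        have "A.\<pi> \<sigma> \<in> S i ` K" "A.\<pi> \<tau> \<in> S j ` K"
          unfolding i(4) j(4) using i(3) j(3) A.address_in_K by blast+
        then have "A.\<pi> \<sigma> \<in> S i ` V" "A.\<pi> \<sigma> \<in> S j ` V"
          using meet[OF i(2) j(2) False] st(3) by auto
        then have uv: "A.\<pi> \<rho> \<in> V" "A.\<pi> \<upsilon> \<in> V"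
          using A.inj_S[OF i(2), of "A.\<pi> \<rho>"] A.inj_S[OF j(2), of "A.\<pi> \<upsilon>"] i(4) j(4) st(3)
          by (metis imageE)+
        \<comment> \<open>The tails address points of \<open>V\<close>, so \<open>vertex\<close> and
          the equivariance of \<open>f\<close> express \<open>x\<close> and \<open>y\<close> as the
          value of \<open>f\<close> at the same point.\<close>
        have "x = f (S i (A.\<pi> \<rho>))" "y = f (S j (A.\<pi> \<upsilon>))"
          using xy uv vertex i(2,3) j(2,3) f(2) by auto
        then show ?thesis
          using i(4) j(4) st(3) by auto
      qed
    qed
  qed
qed

text \<open>Well-definedness on addresses is enough. Continuity comes from the correspondence of
  pieces with equal words, and uniqueness from the fact that every point of \<open>K\<close> has an
  address.\<close>

lemma ex1_address_preserving:
  assumes wd: "\<And>\<sigma> \<tau>. \<sigma> \<in> streams {1..m} \<Longrightarrow> \<tau> \<in> streams {1..m} \<Longrightarrow> A.\<pi> \<sigma> = A.\<pi> \<tau> \<Longrightarrow>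
      B.\<pi> \<sigma> = B.\<pi> \<tau>"
  shows "\<exists>!g. address_preserving m S K S' K' g"
proof -
  have "\<forall>x\<in>K. \<exists>\<sigma>. \<sigma> \<in> streams {1..m} \<and> A.\<pi> \<sigma> = x"
    using A.address_surj by metis
  then obtain a where a: "\<And>x. x \<in> K \<Longrightarrow> a x \<in> streams {1..m}" "\<And>x. x \<in> K \<Longrightarrow> A.\<pi> (a x) = x"
    by metis
  \<comment> \<open>\<open>a\<close> picks one address per point of \<open>K\<close>. The
    restriction makes \<open>g\<close> extensional, as membership in
    \<open>K \<rightarrow>\<^sub>E K'\<close> demands.\<close>
  define g where "g = restrict (\<lambda>x. B.\<pi> (a x)) K"
  have g: "g (A.\<pi> \<sigma>) = B.\<pi> \<sigma>" if "\<sigma> \<in> streams {1..m}" for \<sigma>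
    unfolding g_def using A.address_in_K[OF that] wd[OF _ that] a by simp
  \<comment> \<open>Prefixing an address with \<open>w\<close> applies the word map on both sides,
    so \<open>g\<close> sends the piece of \<open>K\<close> for \<open>w\<close> into the piece of
    \<open>K'\<close> for the same word.\<close>
  have g_word: "g x \<in> word_map S' w ` K'"
    if w: "set w \<subseteq> {1..m}" and x: "x \<in> word_map S w ` K" for w x
  proof -
    obtain y where "y \<in> K" "x = word_map S w y"
      using x by blast
    then have "x = A.\<pi> (w @- a y)"
      using A.address_shift[OF w] a by simp
    moreover have "w @- a y \<in> streams {1..m}"
      using w a(1)[OF \<open>y \<in> K\<close>] by (auto intro: shift_streams)
    ultimately show ?thesis
      using g B.address_shift[OF w a(1)[OF \<open>y \<in> K\<close>]] B.address_in_K[OF a(1)[OF \<open>y \<in> K\<close>]]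
      by auto
  qed
  have "continuous_on K g"
    unfolding continuous_on_iff
  proof (intro ballI allI impI)
    fix x and \<epsilon> :: real assume "x \<in> K" "\<epsilon> > 0"
    obtain n where n: "\<And>w x y. set w \<subseteq> {1..m} \<Longrightarrow> length w = n \<Longrightarrow> x \<in> K' \<Longrightarrow> y \<in> K' \<Longrightarrow>
        dist (word_map S' w x) (word_map S' w y) < \<epsilon>"
      using B.word_map_images_shrink[OF \<open>\<epsilon> > 0\<close> compact_imp_bounded[OF B.compact_K]] by blast
    \<comment> \<open>Near \<open>x\<close>, \<open>K\<close> meets only those pieces of level \<open>n\<close> that contain \<open>x\<close>.\<close>
    define W where "W = {w. set w \<subseteq> {1..m} \<and> length w = n}"
    define C where "C = (\<Union>w \<in> {w \<in> W. x \<notin> word_map S w ` K}. word_map S w ` K)"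
    have "finite W"
      unfolding W_def by (rule finite_lists_length_eq) simp
    moreover have "closed (word_map S w ` K)" if "w \<in> W" for w
      using that unfolding W_def by (auto intro: compact_imp_closed A.compact_word_map_image)
    ultimately have "closed C"
      unfolding C_def by (intro closed_UN) auto
    moreover have "x \<notin> C"
      unfolding C_def by auto
    ultimately obtain d where d: "d > 0" "\<And>y. dist y x < d \<Longrightarrow> y \<notin> C"
      by (metis closed_approachable)
    have "dist (g y) (g x) < \<epsilon>" if y: "y \<in> K" "dist y x < d" for y
    proof -
      obtain w where w: "set w \<subseteq> {1..m}" "length w = n" "y \<in> word_map S w ` K"
        using A.word_map_cover[OF y(1)] .
      then have "x \<in> word_map S w ` K"
        using d(2)[OF y(2)] unfolding C_def W_def by auto
      with w show ?thesis
        using g_word[OF w(1), of x] g_word[OF w(1), of y] n[OF w(1,2)] by auto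
    qed
    then show "\<exists>d>0. \<forall>y\<in>K. dist y x < d \<longrightarrow> dist (g y) (g x) < \<epsilon>"
      using d(1) by blast
  qed
  moreover have "g \<in> K \<rightarrow>\<^sub>E K'"
    unfolding g_def using a(1) B.address_in_K by auto
  ultimately have "address_preserving m S K S' K' g"
    unfolding address_preserving_def using g by blast
  moreover have "h = g" if "address_preserving m S K S' K' h" for h
  proof (rule PiE_ext)
    show "h \<in> K \<rightarrow>\<^sub>E K'"
      using that unfolding address_preserving_def by blast
    show "g \<in> K \<rightarrow>\<^sub>E K'"
      by fact
    show "h x = g x" if "x \<in> K" for x
      using \<open>address_preserving m S K S' K' h\<close> g[OF a(1)[OF that]] a[OF that]
      unfolding address_preserving_def by auto
  qed
  ultimately show ?thesis
    by blast
qed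

text \<open>A continuous bijection from a compact set onto a Hausdorff space is a homeomorphism.
  Surjectivity holds because every point of \<open>K'\<close> has an address, and injectivity is
  exactly the converse implication between equal addresses.\<close>

lemma address_preserving_homeomorphism:
  assumes inj: "\<And>\<sigma> \<tau>. \<sigma> \<in> streams {1..m} \<Longrightarrow> \<tau> \<in> streams {1..m} \<Longrightarrow> B.\<pi> \<sigma> = B.\<pi> \<tau> \<Longrightarrow>
      A.\<pi> \<sigma> = A.\<pi> \<tau>"
    and g: "address_preserving m S K S' K' g"
  shows "\<exists>h. homeomorphism K K' g h"
proof -
  have g': "g \<in> K \<rightarrow> K'" "continuous_on K g" "\<And>\<sigma>. \<sigma> \<in> streams {1..m} \<Longrightarrow> g (A.\<pi> \<sigma>) = B.\<pi> \<sigma>"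
    using g unfolding address_preserving_def by auto
  have "K' \<subseteq> g ` K"
    by (metis A.address_in_K B.address_surj g'(3) imageI subsetI)
  moreover have "inj_on g K"
    using A.address_surj g'(3) inj by (intro inj_onI) metis
  ultimately show ?thesis
    using homeomorphism_compact[OF A.compact_K g'(2)] g'(1) by (metis Pi_iff image_subsetI subset_antisym)
qed

end

section \<open>Polygons\<close>

lemma set_subset_path_image_polyline: "set vs \<subseteq> path_image (polyline vs)"
proof (induction vs rule: polyline.induct)
  case (4 a b c cs)
  have "pathfinish (linepath a b) = pathstart (polyline (b # c # cs))"
    by (cases cs) (auto simp: pathstart_join)
  with 4 show ?case
    by (auto simp: path_image_join)
qed auto

lemma vertices_subset: "vertices P \<subseteq> P"
  unfolding vertices_def polygon_region_def closed_polyline_def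
  using set_subset_path_image_polyline by fastforce

text \<open>Compactness is transported from the disk along the homeomorphism in the definition of
  \<open>polygon\<close>.\<close>

lemma polygon_compact: "polygon P \<Longrightarrow> compact P"
  unfolding polygon_def using homeomorphic_compactness compact_cball by blast

lemma polygon_nonempty: "polygon P \<Longrightarrow> P \<noteq> {}"
  unfolding polygon_def by (metis cball_eq_empty homeomorphic_empty(2) not_one_less_zero)

lemma polygon_bounded_vertices: "polygon P \<Longrightarrow> bounded (vertices P)"
  by (meson bounded_subset compact_imp_bounded polygon_compact vertices_subset)

section \<open>Polygonal systems and their deformations\<close>

theorem theorem14:
  fixes \<delta> :: real and m :: nat
    and S S' :: "nat \<Rightarrow> complex \<Rightarrow> complex"
    and P P' K K' :: "complex set"
  assumes "\<delta> > 0"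
    and "contractible_polygonal_system m S P"
    and "is_attractor m S K"
    and "generalized_polygonal_system m S' P'"
    and "is_deformation \<delta> m S P S' P'"
    and "is_attractor m S' K'"
  shows "(\<exists>!f. address_preserving m S K S' K' f) \<and>
    ((\<forall>i \<in> {1..m}. \<forall>j \<in> {1..m}. i \<noteq> j \<longrightarrow> S' i ` K' \<inter> S' j ` K' = S' i ` P' \<inter> S' j ` P') \<longrightarrow>
      (\<forall>f. address_preserving m S K S' K' f \<longrightarrow> (\<exists>g. homeomorphism K K' f g)))"
proof -
  have S: "polygon P" "\<And>i. i \<in> {1..m} \<Longrightarrow> contracting_similarity (S i)"
    "\<And>i j. i \<in> {1..m} \<Longrightarrow> j \<in> {1..m} \<Longrightarrow> i \<noteq> j \<Longrightarrow>
      S i ` P \<inter> S j ` P = S i ` vertices P \<inter> S j ` vertices P"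
    "vertices P \<subseteq> (\<Union>i \<in> {1..m}. S i ` vertices P)"
    "\<And>i. i \<in> {1..m} \<Longrightarrow> S i ` P \<subseteq> P"
    using assms(2) unfolding contractible_polygonal_system_def generalized_polygonal_system_def
    by blast+
  have S': "polygon P'" "\<And>i. i \<in> {1..m} \<Longrightarrow> contracting_similarity (S' i)"
    "\<And>i j. i \<in> {1..m} \<Longrightarrow> j \<in> {1..m} \<Longrightarrow> i \<noteq> j \<Longrightarrow>
      S' i ` P' \<inter> S' j ` P' = S' i ` vertices P' \<inter> S' j ` vertices P'"
    "vertices P' \<subseteq> (\<Union>i \<in> {1..m}. S' i ` vertices P')"
    using assms(4) unfolding generalized_polygonal_system_def by blast+
  interpret ifs_pair m S K S' K'
    by unfold_locales (use S(2) S'(2) assms(3,6) in auto)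
  \<comment> \<open>Exchanging the two systems makes the transfer of equal addresses available in
    the opposite direction.\<close>
  interpret swapped: ifs_pair m S' K' S K ..
  obtain f where f: "inj_on f (\<Union>k \<in> {1..m}. S k ` vertices P)" "f ` vertices P = vertices P'"
    "\<And>k x. k \<in> {1..m} \<Longrightarrow> x \<in> vertices P \<Longrightarrow> f (S k x) = S' k (f x)"
    using assms(5) unfolding is_deformation_def by (auto simp: bij_betw_def)
  \<comment> \<open>This is where (D1) enters: \<open>P\<close> is closed and mapped into itself. It
    reduces intersections of pieces of \<open>K\<close> to intersections of pieces of
    \<open>P\<close>, which (D2) controls.\<close>
  have "K \<subseteq> P"
  proof (rule A.self_covering_subset)
    show "bounded K" "K \<subseteq> (\<Union>i \<in> {1..m}. S i ` K)"
      using A.compact_K compact_imp_bounded A.K_eq by blast+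
    show "closed P" "P \<noteq> {}"
      using S(1) polygon_compact polygon_nonempty compact_imp_closed by blast+
  qed (rule S(5))
  have "B.\<pi> \<sigma> = B.\<pi> \<tau>"
    if "\<sigma> \<in> streams {1..m}" "\<tau> \<in> streams {1..m}" "A.\<pi> \<sigma> = A.\<pi> \<tau>" for \<sigma> \<tau>
  proof (rule address_eq_transfer[OF _ S(4) _ _ f(3) that])
    show "bounded (vertices P)" "bounded (f ` vertices P)"
      using polygon_bounded_vertices S(1) S'(1) f(2) by auto
    show "S i ` K \<inter> S j ` K \<subseteq> S i ` vertices P \<inter> S j ` vertices P"
      if "i \<in> {1..m}" "j \<in> {1..m}" "i \<noteq> j" for i j
      using S(3)[OF that] \<open>K \<subseteq> P\<close> by blast
  qed
  then have "\<exists>!g. address_preserving m S K S' K' g"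
    by (rule ex1_address_preserving)
  moreover have "\<exists>h. homeomorphism K K' g h"
    if meet: "\<forall>i \<in> {1..m}. \<forall>j \<in> {1..m}. i \<noteq> j \<longrightarrow> S' i ` K' \<inter> S' j ` K' = S' i ` P' \<inter> S' j ` P'"
      and g: "address_preserving m S K S' K' g" for g
  proof (rule address_preserving_homeomorphism[OF _ g])
    \<comment> \<open>The inverse is taken on the vertices of all pieces; by (D3) these include the
      vertices of \<open>P\<close>.\<close>
    define f' where "f' = inv_into (\<Union>k \<in> {1..m}. S k ` vertices P) f"
    have f'f: "f' (f x) = x" if "x \<in> (\<Union>k \<in> {1..m}. S k ` vertices P)" for x
      unfolding f'_def using f(1) that by (rule inv_into_f_f)
    fix \<sigma> \<tau> assume st: "\<sigma> \<in> streams {1..m}" "\<tau> \<in> streams {1..m}" "B.\<pi> \<sigma> = B.\<pi> \<tau>"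
    show "A.\<pi> \<sigma> = A.\<pi> \<tau>"
    proof (rule swapped.address_eq_transfer[OF _ S'(4) _ _ _ st, of f'])
      have "f' ` vertices P' = vertices P"
        unfolding f(2)[symmetric] image_image using f'f S(4) by (force simp: image_iff)
      then show "bounded (vertices P')" "bounded (f' ` vertices P')"
        using polygon_bounded_vertices S(1) S'(1) by auto
      \<comment> \<open>(D1) is not assumed of the deformed system, so
        \<open>K' \<subseteq> P'\<close> is not at hand; the hypothesis of (ii) replaces it
        here.\<close>
      show "S' i ` K' \<inter> S' j ` K' \<subseteq> S' i ` vertices P' \<inter> S' j ` vertices P'"
        if "i \<in> {1..m}" "j \<in> {1..m}" "i \<noteq> j" for i j
        using S'(3)[OF that] meet[rule_format, OF that] by simp
      \<comment> \<open>Equivariance passes to the inverse: write \<open>x = f v\<close>, move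
        \<open>S' i\<close> inside \<open>f\<close>, and cancel \<open>f'\<close> against
        \<open>f\<close> at \<open>S i v\<close> and at \<open>v\<close>.\<close>
      show "f' (S' i x) = S i (f' x)" if "i \<in> {1..m}" "x \<in> vertices P'" for i x
      proof -
        obtain v where v: "v \<in> vertices P" "x = f v"
          using f(2) \<open>x \<in> vertices P'\<close> by blast
        have "f' (S' i x) = f' (f (S i v))"
          using f(3) that(1) v by simp
        also have "\<dots> = S i v"
          using that(1) v(1) by (intro f'f) auto
        also have "\<dots> = S i (f' x)"
          using f'f[OF subsetD[OF S(4) v(1)]] v(2) by simp
        finally show ?thesis .
      qed
    qed
  qed
  ultimately show ?thesis
    by blast
qed

end
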